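(* Let $\mu$ be an unconditional log-concave measure on $\mathbb{R}^n$, and let $K \subset \mathbb{R}^n$ be a symmetric convex body. Then $$\mu(K)\,\mu(K^o) \leq \mu(B)^2,$$ where $B = \{x \in \mathbb{R}^n : \|x\|_2 \leq 1\}$ is the Euclidean unit ball (note $B^o = B$).
   Context: A convex body is a compact convex set with non-empty interior; it is symmetric if $K = -K$. The polar body is $K^o := \{y \in \mathbb{R}^n : \langle x, y\rangle \leq 1 \text{ for all } x \in K\}$. A measure $\mu$ on $\mathbb{R}^n$ is log-concave if it is absolutely continuous with density $f_\mu$ such that $\log f_\mu : \mathbb{R}^n \to \mathbb{R}\cup\{-\infty\}$ is concave. It is unconditional (with respect to the standard basis) if $f_\mu(\varepsilon_1 x_1, \dots, \varepsilon_n x_n) = f_\mu(x_1,\dots,x_n)$ for all $x \in \mathbb{R}^n$ and all $\varepsilon \in \{\pm 1\}^n$. *)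

theory Defs
  imports "HOL-Analysis.Analysis"
begin

definition elog :: "real \<Rightarrow> ereal" where
  "elog r = (if r > 0 then ereal (ln r) else -\<infinity>)"

definition log_concave_density :: "(real^'n \<Rightarrow> real) \<Rightarrow> bool" where
  "log_concave_density f \<longleftrightarrow>
     f \<in> borel_measurable borel \<and> (\<forall>x. 0 \<le> f x) \<and>
     (\<forall>x y t. 0 \<le> t \<and> t \<le> 1 \<longrightarrow>
        ereal (1 - t) * elog (f x) + ereal t * elog (f y)
          \<le> elog (f ((1 - t) *\<^sub>R x + t *\<^sub>R y)))"

definition unconditional :: "(real^'n \<Rightarrow> real) \<Rightarrow> bool" where
  "unconditional f \<longleftrightarrow>
     (\<forall>x (\<epsilon>::'n \<Rightarrow> real). (\<forall>i. \<epsilon> i = 1 \<or> \<epsilon> i = -1) \<longrightarrow>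
        f (\<chi> i. \<epsilon> i * x $ i) = f x)"

definition convex_body :: "(real^'n) set \<Rightarrow> bool" where
  "convex_body K \<longleftrightarrow> compact K \<and> convex K \<and> interior K \<noteq> {}"

definition symmetric_set :: "(real^'n) set \<Rightarrow> bool" where
  "symmetric_set K \<longleftrightarrow> uminus ` K = K"

definition polar :: "(real^'n) set \<Rightarrow> (real^'n) set" where
  "polar K = {y. \<forall>x\<in>K. inner x y \<le> 1}"

end

theory Submission
  imports Defs
begin

text \<open>Steiner symmetrization in a coordinate direction increases both \<open>\<mu>(K)\<close> and \<open>\<mu>(K\<^sup>o)\<close>: by
  Fubini, the first claim is the one-dimensional Prekopa-Leindler inequality on lines parallel to
  \<open>e\<^sub>i\<close>, and the second is the \<open>(n-1)\<close>-dimensional one on the hyperplanes \<open>x\<^sub>i = s\<close>, because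
  \<open>(u' - v')/2\<close> lies in the slice at height \<open>s\<close> of the polar of the symmetral whenever \<open>u'\<close> and
  \<open>v'\<close> lie in the slice at height \<open>s\<close> of \<open>K\<^sup>o\<close>. After symmetrizing in every coordinate \<open>K\<close> is
  unconditional. Then \<open>x \<in> K\<close>, \<open>y \<in> K\<^sup>o\<close> and \<open>z\<^sub>i\<^sup>2 = \<bar>x\<^sub>i y\<^sub>i\<bar>\<close> imply \<open>z \<in> B\<close> and
  \<open>f(x) f(y) \<le> f(z)\<^sup>2\<close>, and the multiplicative form of the Prekopa-Leindler inequality concludes.\<close>

section \<open>The Prekopa-Leindler inequality\<close>

text \<open>A ternary relation, rather than a midpoint operation, also covers the multiplicative version,
  where \<open>z\<^sup>2 = \<bar>x y\<bar>\<close> leaves the sign of \<open>z\<close> free.\<close>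

definition prekopa_leindler :: "'a measure \<Rightarrow> ('a \<Rightarrow> 'a \<Rightarrow> 'a \<Rightarrow> bool) \<Rightarrow> bool" where
  "prekopa_leindler M R \<longleftrightarrow>
     (\<forall>f\<in>borel_measurable M. \<forall>g\<in>borel_measurable M. \<forall>h\<in>borel_measurable M.
        (\<forall>x\<in>space M. \<forall>y\<in>space M. \<forall>z\<in>space M. R x y z \<longrightarrow> f x * g y \<le> (h z :: ennreal)\<^sup>2) \<longrightarrow>
        integral\<^sup>N M f * integral\<^sup>N M g \<le> (integral\<^sup>N M h)\<^sup>2)"

lemma prekopa_leindlerI:
  assumes "\<And>f g h. f \<in> borel_measurable M \<Longrightarrow> g \<in> borel_measurable M \<Longrightarrow> h \<in> borel_measurable M \<Longrightarrow>
    (\<And>x y z. x \<in> space M \<Longrightarrow> y \<in> space M \<Longrightarrow> z \<in> space M \<Longrightarrow> R x y z \<Longrightarrow> f x * g y \<le> (h z :: ennreal)\<^sup>2) \<Longrightarrow>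
    integral\<^sup>N M f * integral\<^sup>N M g \<le> (integral\<^sup>N M h)\<^sup>2"
  shows "prekopa_leindler M R"
  using assms unfolding prekopa_leindler_def by blast

lemma prekopa_leindlerD:
  assumes "prekopa_leindler M R"
    and "f \<in> borel_measurable M" "g \<in> borel_measurable M" "h \<in> borel_measurable M"
    and "\<And>x y z. x \<in> space M \<Longrightarrow> y \<in> space M \<Longrightarrow> z \<in> space M \<Longrightarrow> R x y z \<Longrightarrow> f x * g y \<le> (h z :: ennreal)\<^sup>2"
  shows "integral\<^sup>N M f * integral\<^sup>N M g \<le> (integral\<^sup>N M h)\<^sup>2"
  using assms unfolding prekopa_leindler_def by blast

section \<open>Tensorization over finite products\<close>

text \<open>Induction with Fubini: if \<open>x\<close>, \<open>y\<close>, \<open>z\<close> are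
  related in all coordinates of \<open>I\<close>, the inequality in the new coordinate says that the
  inner integrals satisfy the pointwise hypothesis of the inequality over \<open>I\<close>.\<close>

lemma prekopa_leindler_PiM:
  assumes I: "finite I" and sf: "\<And>i. sigma_finite_measure (M i)"
    and pl: "\<And>i. i \<in> I \<Longrightarrow> prekopa_leindler (M i) (R i)"
  shows "prekopa_leindler (Pi\<^sub>M I M) (\<lambda>x y z. \<forall>i\<in>I. R i (x i) (y i) (z i))"
  using I pl
proof (induction I rule: finite_induct)
  case empty
  show ?case
  proof (rule prekopa_leindlerI)
    interpret product_sigma_finite M
      by (rule product_sigma_finite.intro) (rule sf)
    fix f g h :: "('a \<Rightarrow> 'b) \<Rightarrow> ennreal"
    assume "\<And>x y z. x \<in> space (Pi\<^sub>M {} M) \<Longrightarrow> y \<in> space (Pi\<^sub>M {} M) \<Longrightarrow> z \<in> space (Pi\<^sub>M {} M) \<Longrightarrow>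
      \<forall>i\<in>{}. R i (x i) (y i) (z i) \<Longrightarrow> f x * g y \<le> (h z)\<^sup>2"
    \<comment> \<open>The empty product is a point mass, so each integral is a single value of its
      function.\<close>
    then show "integral\<^sup>N (Pi\<^sub>M {} M) f * integral\<^sup>N (Pi\<^sub>M {} M) g \<le> (integral\<^sup>N (Pi\<^sub>M {} M) h)\<^sup>2"
      by (simp add: PiM_empty nn_integral_count_space_finite)
  qed
next
  case (insert i I)
  interpret product_sigma_finite M
    by (rule product_sigma_finite.intro) (rule sf)
  interpret sigma_finite_measure "M i" by (rule sf)
  let ?N = "Pi\<^sub>M I M"
  have upd: "x(i := s) \<in> space (Pi\<^sub>M (insert i I) M)"
    if "x \<in> space ?N" "s \<in> space (M i)" for x s
    using that by (auto simp: space_PiM intro!: PiE_fun_upd)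
  show ?case
  proof (rule prekopa_leindlerI)
    fix f g h :: "('a \<Rightarrow> 'b) \<Rightarrow> ennreal"
    assume m[measurable]: "f \<in> borel_measurable (Pi\<^sub>M (insert i I) M)" "g \<in> borel_measurable (Pi\<^sub>M (insert i I) M)"
      "h \<in> borel_measurable (Pi\<^sub>M (insert i I) M)"
      and fgh: "\<And>x y z. x \<in> space (Pi\<^sub>M (insert i I) M) \<Longrightarrow> y \<in> space (Pi\<^sub>M (insert i I) M) \<Longrightarrow>
        z \<in> space (Pi\<^sub>M (insert i I) M) \<Longrightarrow> \<forall>j\<in>insert i I. R j (x j) (y j) (z j) \<Longrightarrow> f x * g y \<le> (h z)\<^sup>2"
    have "(\<integral>\<^sup>+x. (\<integral>\<^sup>+s. f (x(i := s)) \<partial>M i) \<partial>?N) * (\<integral>\<^sup>+x. (\<integral>\<^sup>+s. g (x(i := s)) \<partial>M i) \<partial>?N)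
        \<le> (\<integral>\<^sup>+x. (\<integral>\<^sup>+s. h (x(i := s)) \<partial>M i) \<partial>?N)\<^sup>2"
    proof (rule prekopa_leindlerD[OF insert.IH])
      fix x y z assume x: "x \<in> space ?N" "y \<in> space ?N" "z \<in> space ?N"
        and R: "\<forall>j\<in>I. R j (x j) (y j) (z j)"
      note [measurable] = x
      show "(\<integral>\<^sup>+s. f (x(i := s)) \<partial>M i) * (\<integral>\<^sup>+s. g (y(i := s)) \<partial>M i) \<le> (\<integral>\<^sup>+s. h (z(i := s)) \<partial>M i)\<^sup>2"
      proof (rule prekopa_leindlerD[OF insert.prems[of i]])
        fix s t r assume "s \<in> space (M i)" "t \<in> space (M i)" "r \<in> space (M i)" "R i s t r"
        then show "f (x(i := s)) * g (y(i := t)) \<le> (h (z(i := r)))\<^sup>2"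
          using x R insert.hyps by (intro fgh upd) auto
      qed (simp, measurable)
    qed (use insert.prems in \<open>auto intro!: borel_measurable_nn_integral\<close>, measurable)
    then show "integral\<^sup>N (Pi\<^sub>M (insert i I) M) f * integral\<^sup>N (Pi\<^sub>M (insert i I) M) g
        \<le> (integral\<^sup>N (Pi\<^sub>M (insert i I) M) h)\<^sup>2"
      using insert.hyps by (simp add: product_nn_integral_insert)
  qed
qed

section \<open>Elementary inequalities in \<open>ennreal\<close>\<close>

lemma ennreal_power2_le_iff: "x\<^sup>2 \<le> y\<^sup>2 \<longleftrightarrow> x \<le> (y::ennreal)"
proof (cases x; cases y)
  fix a b assume "x = ennreal a" "0 \<le> a" "y = ennreal b" "0 \<le> b"
  then show ?thesis by (simp add: ennreal_power power_mono_iff)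
qed (auto simp: top_unique power_eq_top_ennreal)

lemma ennreal_am_gm: "4 * (x * y) \<le> (x + y)\<^sup>2" for x y :: ennreal
proof (cases x; cases y)
  fix a b assume *: "x = ennreal a" "0 \<le> a" "y = ennreal b" "0 \<le> b"
  have "4 * (a * b) \<le> (a + b)\<^sup>2"
    using zero_le_power2[of "a - b"] by (simp add: power2_eq_square algebra_simps)
  then show ?thesis
    using * by (simp add: ennreal_power flip: ennreal_plus ennreal_mult ennreal_numeral)
qed (auto simp: power_eq_top_ennreal)

section \<open>Brunn-Minkowski on the real line\<close>

text \<open>The set on the left is \<open>(S + t) / 2\<close>, a translate of \<open>S\<close>
  scaled by one half; keeping the factor 2 beside it avoids division in
  \<open>ennreal\<close>.\<close>

lemma emeasure_lborel_affine_image: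
  fixes S :: "real set"
  assumes [measurable]: "S \<in> sets borel"
  shows "emeasure lborel {x. 2 * x - t \<in> S} * 2 = emeasure lborel S"
proof -
  have "emeasure lborel S = (\<integral>\<^sup>+x. indicator S x \<partial>lborel)" by simp
  also have "\<dots> = 2 * (\<integral>\<^sup>+x. indicator S (- t + 2 * x) \<partial>lborel)"
    by (subst nn_integral_real_affine[where c=2 and t="-t"]) auto
  also have "(\<integral>\<^sup>+x. indicator S (- t + 2 * x) \<partial>lborel) = (\<integral>\<^sup>+x. indicator {x. 2 * x - t \<in> S} x \<partial>lborel)"
    by (intro nn_integral_cong) (auto split: split_indicator)
  also have "\<dots> = emeasure lborel {x. 2 * x - t \<in> S}"
    by (intro nn_integral_indicator) measurable
  finally show ?thesis by (simp add: mult.commute)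
qed

text \<open>The translates \<open>a + B\<close> and \<open>A + b\<close> overlap only slightly when \<open>a\<close> is close to \<open>Sup A\<close>
  and \<open>b\<close> is close to \<open>Inf B\<close>.\<close>
lemma brunn_minkowski_real:
  fixes A B C :: "real set"
  assumes m[measurable]: "A \<in> sets borel" "B \<in> sets borel" "C \<in> sets borel"
    and ne: "A \<noteq> {}" "B \<noteq> {}" and bd: "bdd_above A" "bdd_below B"
    and mid: "\<And>x y. x \<in> A \<Longrightarrow> y \<in> B \<Longrightarrow> (x + y) / 2 \<in> C"
  shows "emeasure lborel A + emeasure lborel B \<le> 2 * emeasure lborel C"
proof (rule ennreal_le_epsilon)
  fix e :: real assume e: "0 < e"
  obtain a where a: "a \<in> A" "Sup A - e / 2 < a"
    using less_cSup_iff[OF ne(1) bd(1), of "Sup A - e / 2"] e by auto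
  obtain b where b: "b \<in> B" "b < Inf B + e / 2"
    using cInf_less_iff[OF ne(2) bd(2), of "Inf B + e / 2"] e by auto
  \<comment> \<open>Cutting \<open>A\<close> off at \<open>a\<close> and \<open>B\<close> at
    \<open>b\<close> removes measure at most \<open>e / 2\<close> from each.\<close>
  let ?A = "A \<inter> {..<a}" and ?B = "B \<inter> {b..}"
  have "emeasure lborel A \<le> emeasure lborel (?A \<union> {a..Sup A})"
    using cSup_upper[OF _ bd(1)] by (intro emeasure_mono) force+
  also have "\<dots> \<le> emeasure lborel ?A + emeasure lborel {a..Sup A}"
    by (intro emeasure_subadditive) auto
  also have "\<dots> \<le> emeasure lborel ?A + ennreal (e / 2)"
    using a cSup_upper[OF a(1) bd(1)] by (intro add_left_mono) (simp add: ennreal_leI)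
  finally have A: "emeasure lborel A \<le> emeasure lborel ?A + ennreal (e / 2)" .
  have "emeasure lborel B \<le> emeasure lborel (?B \<union> {Inf B..b})"
    using cInf_lower[OF _ bd(2)] by (intro emeasure_mono) force+
  also have "\<dots> \<le> emeasure lborel ?B + emeasure lborel {Inf B..b}"
    by (intro emeasure_subadditive) auto
  also have "\<dots> \<le> emeasure lborel ?B + ennreal (e / 2)"
    using b cInf_lower[OF b(1) bd(2)] by (intro add_left_mono) (simp add: ennreal_leI)
  finally have B: "emeasure lborel B \<le> emeasure lborel ?B + ennreal (e / 2)" .
  \<comment> \<open>These are \<open>(?A + b) / 2\<close> and \<open>(a + ?B) / 2\<close>. The first
    lies strictly below \<open>(a + b) / 2\<close> and the second at or above it, so they are
    disjoint.\<close>
  let ?A' = "{x. 2 * x - b \<in> ?A}" and ?B' = "{x. 2 * x - a \<in> ?B}"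
  have sub: "?A' \<union> ?B' \<subseteq> C"
  proof
    fix x assume "x \<in> ?A' \<union> ?B'"
    then have "((2 * x - b) + b) / 2 \<in> C \<or> (a + (2 * x - a)) / 2 \<in> C"
      using mid[of "2 * x - b" b] mid[of a "2 * x - a"] a b by blast
    then show "x \<in> C" by simp
  qed
  have "emeasure lborel ?A' + emeasure lborel ?B' = emeasure lborel (?A' \<union> ?B')"
    by (intro plus_emeasure) auto
  also have "\<dots> \<le> emeasure lborel C"
    using sub by (intro emeasure_mono) auto
  finally have "(emeasure lborel ?A' + emeasure lborel ?B') * 2 \<le> emeasure lborel C * 2"
    by (rule mult_right_mono) simp
  moreover have "emeasure lborel ?A' * 2 = emeasure lborel ?A" "emeasure lborel ?B' * 2 = emeasure lborel ?B"
    by (rule emeasure_lborel_affine_image, measurable)+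
  ultimately have AB: "emeasure lborel ?A + emeasure lborel ?B \<le> 2 * emeasure lborel C"
    by (simp only: distrib_right mult.commute[of 2])
  have "emeasure lborel A + emeasure lborel B
     \<le> (emeasure lborel ?A + ennreal (e / 2)) + (emeasure lborel ?B + ennreal (e / 2))"
    by (intro add_mono A B)
  also have "\<dots> = emeasure lborel ?A + emeasure lborel ?B + (ennreal (e / 2) + ennreal (e / 2))"
    by (simp add: ac_simps)
  also have "ennreal (e / 2) + ennreal (e / 2) = ennreal e"
    using e by (simp flip: ennreal_plus)
  finally show "emeasure lborel A + emeasure lborel B \<le> 2 * emeasure lborel C + ennreal e"
    using AB by (meson add_right_mono order_trans)
qed

section \<open>Prekopa-Leindler on the real line\<close>

text \<open>For fixed \<open>x\<close> the levels \<open>t\<close> in \<open>{0..<1}\<close> below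
  \<open>u x\<close> form an interval of length \<open>min (u x) 1\<close>; Tonelli exchanges the
  two integrals. The cap at 1 keeps only those levels at which functions with supremum 1 have
  nonempty superlevel sets.\<close>

lemma nn_integral_min_one_layer_cake:
  fixes u :: "real \<Rightarrow> ennreal"
  assumes [measurable]: "u \<in> borel_measurable borel"
  shows "(\<integral>\<^sup>+x. min (u x) 1 \<partial>lborel)
       = (\<integral>\<^sup>+t. indicator {0..<1} t * emeasure lborel {x. ennreal t < u x} \<partial>lborel)"
proof -
  have "(\<integral>\<^sup>+t. indicator {0..<1} t * indicator {x. ennreal t < u x} x \<partial>lborel) = min (u x) 1" for x
  proof -
    define r where "r = enn2real (min (u x) 1)"
    have r: "ennreal r = min (u x) 1" "0 \<le> r" "r \<le> 1"
      unfolding r_def by (auto simp: ennreal_enn2real_if min_def top_unique enn2real_leI)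
    have *: "0 \<le> t \<and> t < 1 \<and> ennreal t < u x \<longleftrightarrow> 0 \<le> t \<and> t < r" for t
    proof -
      have "t < r \<longleftrightarrow> ennreal t < u x \<and> t < 1" if "0 \<le> t"
        using that ennreal_less_iff[of t r] ennreal_less_iff[of t 1] unfolding r(1) by auto
      then show ?thesis
        by auto
    qed
    have "(\<integral>\<^sup>+t. indicator {0..<1} t * indicator {x. ennreal t < u x} x \<partial>lborel)
        = (\<integral>\<^sup>+t. indicator {0..<r} t \<partial>lborel)"
      using * by (intro nn_integral_cong) (auto split: split_indicator)
    also have "\<dots> = ennreal r" using r by simp
    finally show ?thesis using r by simp
  qed
  then have "(\<integral>\<^sup>+x. min (u x) 1 \<partial>lborel)
      = (\<integral>\<^sup>+x. \<integral>\<^sup>+t. indicator {0..<1} t * indicator {x. ennreal t < u x} x \<partial>lborel \<partial>lborel)"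
    by simp
  also have "\<dots> = (\<integral>\<^sup>+t. \<integral>\<^sup>+x. indicator {0..<1} t * indicator {x. ennreal t < u x} x \<partial>lborel \<partial>lborel)"
    by (rule lborel_pair.Fubini') measurable
  also have "\<dots> = (\<integral>\<^sup>+t. indicator {0..<1} t * emeasure lborel {x. ennreal t < u x} \<partial>lborel)"
    by (simp add: nn_integral_cmult)
  finally show ?thesis .
qed

text \<open>After normalizing both suprema to 1, the superlevel sets of both functions are nonempty
  at every level \<open>t < 1\<close>. Brunn-Minkowski compares them level by level, and integration
  over \<open>t\<close> yields an additive inequality. The bound \<open>c\<close> makes the suprema
  finite, the bound \<open>b\<close> makes the superlevel sets bounded.\<close>

lemma prekopa_leindler_lborel_bounded:
  fixes f g h :: "real \<Rightarrow> ennreal"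
  assumes m[measurable]: "f \<in> borel_measurable borel" "g \<in> borel_measurable borel" "h \<in> borel_measurable borel"
    and fgh: "\<And>x y. f x * g y \<le> (h ((x + y) / 2))\<^sup>2"
    and bd: "\<And>x. f x \<le> ennreal c" "\<And>x. g x \<le> ennreal c"
    and supp: "\<And>x. b < \<bar>x\<bar> \<Longrightarrow> f x = 0" "\<And>x. b < \<bar>x\<bar> \<Longrightarrow> g x = 0"
  shows "integral\<^sup>N lborel f * integral\<^sup>N lborel g \<le> (integral\<^sup>N lborel h)\<^sup>2"
proof (cases "(SUP x. f x) = 0 \<or> (SUP x. g x) = 0")
  case True
  then have "f = (\<lambda>_. 0) \<or> g = (\<lambda>_. 0)"
    by (metis SUP_upper UNIV_I le_zero_eq ext)
  then show ?thesis by auto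
next
  case False
  have "(SUP x. f x) < top" "(SUP x. g x) < top"
    using bd by (meson SUP_least ennreal_less_top le_less_trans)+
  then obtain F G where F: "(SUP x. f x) = ennreal F" "0 < F" and G: "(SUP x. g x) = ennreal G" "0 < G"
    using False by (cases "SUP x. f x"; cases "SUP x. g x") (auto simp: less_le)
  \<comment> \<open>Since \<open>H * H = F * G\<close>, dividing \<open>f\<close>, \<open>g\<close>,
    \<open>h\<close> by \<open>F\<close>, \<open>G\<close>, \<open>H\<close> preserves the pointwise
    hypothesis.\<close>
  define H where "H = sqrt (F * G)"
  have H: "0 < H" "H * H = F * G" using F G by (auto simp: H_def)
  define u v w where "u x = f x * ennreal (1 / F)" and "v x = g x * ennreal (1 / G)"
    and "w x = h x * ennreal (1 / H)" for x
  have [measurable]: "u \<in> borel_measurable borel" "v \<in> borel_measurable borel" "w \<in> borel_measurable borel"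
    unfolding u_def v_def w_def by measurable
  have supu: "(SUP x. u x) = 1" and supv: "(SUP x. v x) = 1"
    unfolding u_def v_def SUP_mult_right_ennreal[symmetric]
    using F G by (simp_all flip: ennreal_mult)
  \<comment> \<open>The cap at 1 does not change \<open>u\<close> and \<open>v\<close>; for
    \<open>w\<close> it can only lower the integral, which is the harmless direction.\<close>
  have u1: "min (u x) 1 = u x" and v1: "min (v x) 1 = v x" for x
    using SUP_upper[of x UNIV u] SUP_upper[of x UNIV v] supu supv by (auto simp: min_def)
  have uvw: "u x * v y \<le> (w ((x + y) / 2))\<^sup>2" for x y
  proof -
    have "u x * v y = (f x * g y) * ennreal (1 / F * (1 / G))"
      unfolding u_def v_def using F G by (simp only: ennreal_mult ac_simps divide_nonneg_nonneg zero_le_one less_imp_le)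
    also have "1 / F * (1 / G) = 1 / H * (1 / H)"
      using F G H by simp
    also have "(f x * g y) * ennreal \<dots> \<le> (h ((x + y) / 2))\<^sup>2 * ennreal \<dots>"
      by (intro mult_right_mono fgh) simp
    also have "\<dots> = (w ((x + y) / 2))\<^sup>2"
      unfolding w_def power2_eq_square using H by (simp only: ennreal_mult ac_simps divide_nonneg_nonneg zero_le_one less_imp_le)
    finally show ?thesis .
  qed
  have level: "emeasure lborel {x. ennreal t < u x} + emeasure lborel {x. ennreal t < v x}
      \<le> 2 * emeasure lborel {x. ennreal t < w x}" if t: "0 \<le> t" "t < 1" for t
  proof (rule brunn_minkowski_real)
    have "ennreal t < 1" using t by (simp add: ennreal_less_one_iff)
    then show "{x. ennreal t < u x} \<noteq> {}" "{x. ennreal t < v x} \<noteq> {}"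
      using supu supv by (metis (mono_tags, lifting) less_SUP_iff empty_iff mem_Collect_eq)+
    have "x \<le> b" if "ennreal t < u x" for x
      using that supp(1)[of x] by (cases "b < \<bar>x\<bar>") (auto simp: u_def)
    then show "bdd_above {x. ennreal t < u x}" by (intro bdd_aboveI[of _ b]) simp
    have "- b \<le> x" if "ennreal t < v x" for x
      using that supp(2)[of x] by (cases "b < \<bar>x\<bar>") (auto simp: v_def)
    then show "bdd_below {x. ennreal t < v x}" by (intro bdd_belowI[of _ "- b"]) simp
    fix x y assume "x \<in> {x. ennreal t < u x}" "y \<in> {x. ennreal t < v x}"
    \<comment> \<open>The smaller of \<open>u x\<close> and \<open>v y\<close> is at most their
      geometric mean, which is at most \<open>w\<close> at the midpoint.\<close>
    then have "ennreal t < min (u x) (v y)" by simp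
    moreover have "(min (u x) (v y))\<^sup>2 \<le> u x * v y"
      unfolding power2_eq_square by (intro mult_mono) auto
    then have "min (u x) (v y) \<le> w ((x + y) / 2)"
      using uvw[of x y] ennreal_power2_le_iff order_trans by blast
    ultimately show "(x + y) / 2 \<in> {x. ennreal t < w x}"
      using less_le_trans by blast
  qed measurable
  have "integral\<^sup>N lborel u + integral\<^sup>N lborel v = (\<integral>\<^sup>+x. min (u x) 1 \<partial>lborel) + (\<integral>\<^sup>+x. min (v x) 1 \<partial>lborel)"
    by (simp add: u1 v1)
  also have "\<dots> = (\<integral>\<^sup>+t. indicator {0..<1} t * (emeasure lborel {x. ennreal t < u x} + emeasure lborel {x. ennreal t < v x}) \<partial>lborel)"
    by (simp add: nn_integral_min_one_layer_cake nn_integral_add distrib_left)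
  also have "\<dots> \<le> (\<integral>\<^sup>+t. 2 * (indicator {0..<1} t * emeasure lborel {x. ennreal t < w x}) \<partial>lborel)"
    using level by (intro nn_integral_mono) (auto split: split_indicator)
  also have "\<dots> = 2 * (\<integral>\<^sup>+x. min (w x) 1 \<partial>lborel)"
    by (simp add: nn_integral_min_one_layer_cake nn_integral_cmult)
  also have "\<dots> \<le> 2 * integral\<^sup>N lborel w"
    by (intro mult_left_mono nn_integral_mono) auto
  finally have uvw_int: "integral\<^sup>N lborel u + integral\<^sup>N lborel v \<le> 2 * integral\<^sup>N lborel w" .
  \<comment> \<open>The arithmetic-geometric mean inequality turns the additive estimate into the
    product estimate.\<close>
  have "4 * (integral\<^sup>N lborel u * integral\<^sup>N lborel v) \<le> (2 * integral\<^sup>N lborel w)\<^sup>2"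
    by (rule order_trans[OF ennreal_am_gm power_mono[OF uvw_int]]) simp
  then have "4 * (integral\<^sup>N lborel u * integral\<^sup>N lborel v) \<le> 4 * (integral\<^sup>N lborel w)\<^sup>2"
    by (simp add: power_mult_distrib)
  then have *: "integral\<^sup>N lborel u * integral\<^sup>N lborel v \<le> (integral\<^sup>N lborel w)\<^sup>2"
    by (simp add: ennreal_mult_le_mult_iff)
  have inv: "ennreal c * (y * ennreal (1 / c)) = y" if "0 < c" for c y
    using that by (subst mult.left_commute) (simp flip: ennreal_mult)
  have scale: "integral\<^sup>N lborel f = ennreal F * integral\<^sup>N lborel u"
    "integral\<^sup>N lborel g = ennreal G * integral\<^sup>N lborel v"
    "integral\<^sup>N lborel h = ennreal H * integral\<^sup>N lborel w"
    unfolding u_def v_def w_def using F G H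
    by (simp_all add: inv flip: nn_integral_cmult)
  have "integral\<^sup>N lborel f * integral\<^sup>N lborel g
      = ennreal (F * G) * (integral\<^sup>N lborel u * integral\<^sup>N lborel v)"
    unfolding scale using F G by (simp add: ennreal_mult ac_simps)
  also have "\<dots> \<le> ennreal (H * H) * (integral\<^sup>N lborel w)\<^sup>2"
    unfolding H by (intro mult_left_mono *) simp
  also have "\<dots> = (integral\<^sup>N lborel h)\<^sup>2"
    unfolding scale power2_eq_square using H(1) by (simp only: ennreal_mult less_imp_le ac_simps)
  finally show ?thesis .
qed

text \<open>One parameter bounds both the height and the support, so every truncation meets the
  boundedness hypotheses of \<open>prekopa_leindler_lborel_bounded\<close>.\<close>

definition truncation :: "nat \<Rightarrow> (real \<Rightarrow> ennreal) \<Rightarrow> real \<Rightarrow> ennreal" where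
  "truncation n f x = min (f x) (of_nat n) * indicator {- real n..real n} x"

lemma truncation_measurable[measurable]:
  assumes [measurable]: "f \<in> borel_measurable borel"
  shows "truncation n f \<in> borel_measurable borel"
  unfolding truncation_def by measurable

lemma truncation_le: "truncation n f x \<le> f x"
  by (auto simp: truncation_def split: split_indicator)

text \<open>Monotone convergence: the truncations increase pointwise to \<open>f\<close>.\<close>

lemma nn_integral_truncation:
  assumes [measurable]: "f \<in> borel_measurable borel"
  shows "integral\<^sup>N lborel f = (SUP n. integral\<^sup>N lborel (truncation n f))"
proof -
  have inc: "incseq (\<lambda>n. truncation n f)"
    by (auto simp: incseq_def le_fun_def truncation_def min_le_iff_disj split: split_indicator)
  have "f x = (SUP n. truncation n f x)" for x
  proof (rule antisym)
    obtain N :: nat where N: "\<bar>x\<bar> \<le> real N" using real_arch_simple by blast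
    have "f x = min (f x) (SUP n. of_nat n)"
      by (simp add: ennreal_SUP_of_nat_eq_top)
    also have "\<dots> = (SUP n. min (f x) (of_nat n))"
      by (simp flip: inf_min add: inf_SUP)
    also have "\<dots> \<le> (SUP n. truncation n f x)"
    proof (rule SUP_least)
      fix n :: nat
      \<comment> \<open>For small \<open>n\<close> the point \<open>x\<close> may lie outside the
        interval of truncation; the index \<open>max n N\<close> brings it inside.\<close>
      have "min (f x) (of_nat n) \<le> min (f x) (of_nat (max n N))"
        by (intro min.mono) auto
      also have "\<dots> = truncation (max n N) f x"
        using N by (auto simp: truncation_def split: split_indicator)
      also have "\<dots> \<le> (SUP n. truncation n f x)" by (rule SUP_upper) simp
      finally show "min (f x) (of_nat n) \<le> (SUP n. truncation n f x)" .
    qed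
    finally show "f x \<le> (SUP n. truncation n f x)" .
  qed (intro SUP_least truncation_le)
  then have "integral\<^sup>N lborel f = (\<integral>\<^sup>+x. (SUP n. truncation n f x) \<partial>lborel)"
    by (intro nn_integral_cong)
  also have "\<dots> = (SUP n. integral\<^sup>N lborel (truncation n f))"
    by (rule nn_integral_monotone_convergence_SUP[OF inc]) measurable
  finally show ?thesis .
qed

text \<open>Truncation lowers \<open>f\<close> and \<open>g\<close>, so the pointwise hypothesis
  survives with the same \<open>h\<close>. Independent indices for the two truncations let the
  supremum be taken in each factor separately.\<close>

lemma prekopa_leindler_lborel: "prekopa_leindler lborel (\<lambda>x y z::real. z = (x + y) / 2)"
proof (rule prekopa_leindlerI)
  fix f g h :: "real \<Rightarrow> ennreal"
  assume "f \<in> borel_measurable lborel" "g \<in> borel_measurable lborel" "h \<in> borel_measurable lborel"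
    and fgh: "\<And>x y z. x \<in> space lborel \<Longrightarrow> y \<in> space lborel \<Longrightarrow> z \<in> space lborel \<Longrightarrow>
        z = (x + y) / 2 \<Longrightarrow> f x * g y \<le> (h z)\<^sup>2"
  then have [measurable]: "f \<in> borel_measurable borel" "g \<in> borel_measurable borel" "h \<in> borel_measurable borel"
    by simp_all
  have "integral\<^sup>N lborel (truncation m f) * integral\<^sup>N lborel (truncation n g) \<le> (integral\<^sup>N lborel h)\<^sup>2" for m n
  proof (rule prekopa_leindler_lborel_bounded)
    fix x y :: real
    show "truncation m f x * truncation n g y \<le> (h ((x + y) / 2))\<^sup>2"
      by (rule order_trans[OF mult_mono[OF truncation_le truncation_le] fgh]) auto
    have "of_nat k \<le> ennreal (real (max m n))" if "k = m \<or> k = n" for k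
      using that by (subst ennreal_of_nat_eq_real_of_nat) (auto intro!: ennreal_leI)
    then show "truncation m f x \<le> ennreal (real (max m n))" "truncation n g x \<le> ennreal (real (max m n))"
      by (auto simp: truncation_def min_le_iff_disj split: split_indicator)
    show "truncation m f x = 0" "truncation n g x = 0" if "real (max m n) < \<bar>x\<bar>"
      using that by (auto simp: truncation_def split: split_indicator)
  qed measurable
  then show "integral\<^sup>N lborel f * integral\<^sup>N lborel g \<le> (integral\<^sup>N lborel h)\<^sup>2"
    by (simp add: nn_integral_truncation[of f] nn_integral_truncation[of g]
        SUP_mult_right_ennreal SUP_mult_left_ennreal SUP_le_iff)
qed

section \<open>Difference and multiplicative forms on the real line\<close>

text \<open>Lebesgue measure is invariant under \<open>y \<mapsto> - y\<close>. The relation matches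
  the half-difference in the definition of \<open>steiner\<close>.\<close>

lemma prekopa_leindler_lborel_diff: "prekopa_leindler lborel (\<lambda>x y z::real. z = (x - y) / 2)"
proof (rule prekopa_leindlerI)
  fix f g h :: "real \<Rightarrow> ennreal"
  assume "f \<in> borel_measurable lborel" "g \<in> borel_measurable lborel" "h \<in> borel_measurable lborel"
    and fgh: "\<And>x y z. x \<in> space lborel \<Longrightarrow> y \<in> space lborel \<Longrightarrow> z \<in> space lborel \<Longrightarrow>
        z = (x - y) / 2 \<Longrightarrow> f x * g y \<le> (h z)\<^sup>2"
  then have [measurable]: "f \<in> borel_measurable borel" "g \<in> borel_measurable borel" "h \<in> borel_measurable borel"
    by simp_all
  have "integral\<^sup>N lborel f * (\<integral>\<^sup>+y. g (- y) \<partial>lborel) \<le> (integral\<^sup>N lborel h)\<^sup>2"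
    by (rule prekopa_leindlerD[OF prekopa_leindler_lborel]) (auto intro!: fgh)
  also have "(\<integral>\<^sup>+y. g (- y) \<partial>lborel) = integral\<^sup>N lborel g"
    using nn_integral_real_affine[of g "-1" 0] by simp
  finally show "integral\<^sup>N lborel f * integral\<^sup>N lborel g \<le> (integral\<^sup>N lborel h)\<^sup>2" .
qed

text \<open>The substitution \<open>x = exp s\<close> is carried out on compact intervals that
  exhaust the half-line, and monotone convergence is applied on both sides. The endpoint
  \<open>real n + 1\<close> keeps the interval nondegenerate at \<open>n = 0\<close>.\<close>

lemma nn_integral_exp_substitution:
  fixes f :: "real \<Rightarrow> ennreal"
  assumes [measurable]: "f \<in> borel_measurable borel"
  shows "(\<integral>\<^sup>+x. f x * indicator {0<..} x \<partial>lborel) = (\<integral>\<^sup>+s. f (exp s) * ennreal (exp s) \<partial>lborel)"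
proof -
  have ex: "\<exists>n. \<bar>y\<bar> \<le> real n + 1" for y
    using real_arch_simple[of "\<bar>y\<bar>"] by (metis add_increasing2 zero_le_one)
  have "(\<integral>\<^sup>+x. f x * indicator {0<..} x \<partial>lborel)
      = (\<integral>\<^sup>+x. (SUP n. f x * indicator {exp (- (real n + 1))..exp (real n + 1)} x) \<partial>lborel)"
  proof (intro nn_integral_cong)
    fix x :: real
    have "indicator {0<..} x = (SUP n. indicator {exp (- (real n + 1))..exp (real n + 1)} x :: ennreal)"
    proof (cases "0 < x")
      case True
      obtain n where n: "\<bar>ln x\<bar> \<le> real n + 1" using ex by blast
      then have "exp (- (real n + 1)) \<le> x" "x \<le> exp (real n + 1)"
        using exp_le_cancel_iff[of "- (real n + 1)" "ln x"] exp_le_cancel_iff[of "ln x" "real n + 1"] exp_ln[OF True]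
        by linarith+
      then have "1 \<le> (SUP n. indicator {exp (- (real n + 1))..exp (real n + 1)} x :: ennreal)"
        by (intro SUP_upper2[of n]) auto
      moreover have "(SUP n. indicator {exp (- (real n + 1))..exp (real n + 1)} x :: ennreal) \<le> 1"
        by (intro SUP_least) (auto split: split_indicator)
      ultimately show ?thesis using True by (simp add: antisym)
    next
      case False
      then have "\<not> exp y \<le> x" for y using exp_gt_zero[of y] by linarith
      then show ?thesis using False by simp
    qed
    then show "f x * indicator {0<..} x = (SUP n. f x * indicator {exp (- (real n + 1))..exp (real n + 1)} x)"
      by (simp add: SUP_mult_left_ennreal)
  qed
  also have "\<dots> = (SUP n. \<integral>\<^sup>+x. f x * indicator {exp (- (real n + 1))..exp (real n + 1)} x \<partial>lborel)"
  proof (rule nn_integral_monotone_convergence_SUP)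
    show "incseq (\<lambda>n x. f x * indicator {exp (- (real n + 1))..exp (real n + 1)} x)"
    proof (intro monoI le_funI mult_left_mono)
      fix m n :: nat and x :: real assume "m \<le> n"
      then have "exp (- (real n + 1)) \<le> exp (- (real m + 1))" "exp (real m + 1) \<le> exp (real n + 1)"
        by simp_all
      then have "x \<in> {exp (- (real m + 1))..exp (real m + 1)} \<Longrightarrow> x \<in> {exp (- (real n + 1))..exp (real n + 1)}"
        unfolding atLeastAtMost_iff by linarith
      then show "indicator {exp (- (real m + 1))..exp (real m + 1)} x
          \<le> (indicator {exp (- (real n + 1))..exp (real n + 1)} x :: ennreal)"
        by (rule indicator_leI)
    qed simp
  qed measurable
  also have "\<dots> = (SUP n. \<integral>\<^sup>+s. f (exp s) * ennreal (exp s) * indicator {- (real n + 1)..real n + 1} s \<partial>lborel)"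
    by (intro SUP_cong refl nn_integral_substitution_aux) (auto intro!: derivative_eq_intros continuous_intros)
  also have "\<dots> = (\<integral>\<^sup>+s. (SUP n. f (exp s) * ennreal (exp s) * indicator {- (real n + 1)..real n + 1} s) \<partial>lborel)"
    by (rule nn_integral_monotone_convergence_SUP[symmetric])
      (auto simp: incseq_def le_fun_def split: split_indicator)
  also have "\<dots> = (\<integral>\<^sup>+s. f (exp s) * ennreal (exp s) \<partial>lborel)"
  proof (intro nn_integral_cong)
    fix s :: real
    obtain n where n: "\<bar>s\<bar> \<le> real n + 1" using ex by blast
    show "(SUP n. f (exp s) * ennreal (exp s) * indicator {- (real n + 1)..real n + 1} s) = f (exp s) * ennreal (exp s)"
    proof (rule antisym)
      show "(SUP n. f (exp s) * ennreal (exp s) * indicator {- (real n + 1)..real n + 1} s) \<le> f (exp s) * ennreal (exp s)"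
        by (intro SUP_least) (auto split: split_indicator)
      show "f (exp s) * ennreal (exp s) \<le> (SUP n. f (exp s) * ennreal (exp s) * indicator {- (real n + 1)..real n + 1} s)"
        using n by (intro SUP_upper2[of n]) (auto simp: abs_le_iff)
    qed
  qed
  finally show ?thesis .
qed

lemma nn_integral_exp_substitution_both:
  fixes f :: "real \<Rightarrow> ennreal"
  assumes [measurable]: "f \<in> borel_measurable borel"
  shows "integral\<^sup>N lborel f = (\<integral>\<^sup>+s. f (exp s) * ennreal (exp s) \<partial>lborel)
      + (\<integral>\<^sup>+s. f (- exp s) * ennreal (exp s) \<partial>lborel)"
proof -
  have "integral\<^sup>N lborel f = (\<integral>\<^sup>+x. f x * indicator {0<..} x + f x * indicator {..<0} x \<partial>lborel)"
    by (rule nn_integral_cong_AE, rule eventually_mono[OF AE_lborel_singleton[of 0]])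
      (auto split: split_indicator)
  also have "\<dots> = (\<integral>\<^sup>+x. f x * indicator {0<..} x \<partial>lborel) + (\<integral>\<^sup>+x. f x * indicator {..<0} x \<partial>lborel)"
    by (rule nn_integral_add) auto
  also have "(\<integral>\<^sup>+x. f x * indicator {..<0} x \<partial>lborel) = (\<integral>\<^sup>+x. f (- x) * indicator {0<..} x \<partial>lborel)"
    by (subst nn_integral_real_affine[where c="-1" and t=0]) (auto intro!: nn_integral_cong split: split_indicator)
  finally show ?thesis
    by (simp add: nn_integral_exp_substitution nn_integral_exp_substitution[of "\<lambda>x. f (- x)"])
qed

text \<open>On each pair of half-lines the substitution \<open>x = \<sigma> * exp s\<close>,
  \<open>y = \<tau> * exp t\<close> turns the geometric mean into the midpoint
  \<open>r = (s + t) / 2\<close>. The Jacobians fit because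
  \<open>exp s * exp t = (exp r)\<^sup>2\<close>, so the additive version applies.\<close>

lemma prekopa_leindler_lborel_mult: "prekopa_leindler lborel (\<lambda>x y z::real. z\<^sup>2 = \<bar>x * y\<bar>)"
proof (rule prekopa_leindlerI)
  fix f g h :: "real \<Rightarrow> ennreal"
  assume "f \<in> borel_measurable lborel" "g \<in> borel_measurable lborel" "h \<in> borel_measurable lborel"
    and fgh: "\<And>x y z. x \<in> space lborel \<Longrightarrow> y \<in> space lborel \<Longrightarrow> z \<in> space lborel \<Longrightarrow>
        z\<^sup>2 = \<bar>x * y\<bar> \<Longrightarrow> f x * g y \<le> (h z)\<^sup>2"
  then have [measurable]: "f \<in> borel_measurable borel" "g \<in> borel_measurable borel" "h \<in> borel_measurable borel"
    by simp_all
  \<comment> \<open>\<open>J u \<sigma>\<close> is the integral of \<open>u\<close> over the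
    half-line of sign \<open>\<sigma>\<close>.\<close>
  define J where "J u \<sigma> = (\<integral>\<^sup>+s. u (\<sigma> * exp s) * ennreal (exp s) \<partial>lborel)" for u :: "real \<Rightarrow> ennreal" and \<sigma> :: real
  have J: "integral\<^sup>N lborel u = J u 1 + J u (-1)" if "u \<in> borel_measurable borel" for u
    unfolding J_def using nn_integral_exp_substitution_both[OF that] by simp
  have JJ: "J f \<sigma> * J g \<tau> \<le> (J h \<rho>)\<^sup>2"
    if "\<sigma> \<in> {1, -1}" "\<tau> \<in> {1, -1}" "\<rho> \<in> {1, -1}" for \<sigma> \<tau> \<rho>
    unfolding J_def
  proof (rule prekopa_leindlerD[OF prekopa_leindler_lborel])
    fix s t r :: real assume r: "r = (s + t) / 2"
    have e: "exp s * exp t = exp r * exp r"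
      unfolding r by (simp flip: exp_add)
    have "(\<rho> * exp r)\<^sup>2 = \<bar>(\<sigma> * exp s) * (\<tau> * exp t)\<bar>"
      using that e by (auto simp: power2_eq_square abs_mult)
    then have "f (\<sigma> * exp s) * g (\<tau> * exp t) \<le> (h (\<rho> * exp r))\<^sup>2"
      by (intro fgh) auto
    then have "f (\<sigma> * exp s) * g (\<tau> * exp t) * ennreal (exp s * exp t) \<le> (h (\<rho> * exp r))\<^sup>2 * ennreal (exp r * exp r)"
      unfolding e by (rule mult_right_mono) simp
    then show "f (\<sigma> * exp s) * ennreal (exp s) * (g (\<tau> * exp t) * ennreal (exp t))
        \<le> (h (\<rho> * exp r) * ennreal (exp r))\<^sup>2"
      by (simp add: ennreal_mult power2_eq_square ac_simps)
  qed measurable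
  \<comment> \<open>The sign of \<open>z\<close> is free, so each of the four products is bounded by
    both squares, hence by \<open>m\<^sup>2\<close>; their sum is then at most
    \<open>(m + m)\<^sup>2\<close>.\<close>
  define m where "m = min (J h 1) (J h (-1))"
  have m: "J f \<sigma> * J g \<tau> \<le> m\<^sup>2" if "\<sigma> \<in> {1, -1}" "\<tau> \<in> {1, -1}" for \<sigma> \<tau>
    using JJ[OF that, of 1] JJ[OF that, of "-1"] by (auto simp: m_def min_def)
  have "(J f 1 + J f (-1)) * (J g 1 + J g (-1))
      = (J f 1 * J g 1 + J f 1 * J g (-1)) + (J f (-1) * J g 1 + J f (-1) * J g (-1))"
    by (simp add: distrib_left distrib_right ac_simps)
  also have "\<dots> \<le> (m\<^sup>2 + m\<^sup>2) + (m\<^sup>2 + m\<^sup>2)"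
    by (intro add_mono m) auto
  also have "\<dots> = (m + m)\<^sup>2"
    by (simp add: power2_eq_square distrib_left distrib_right ac_simps)
  also have "\<dots> \<le> (J h 1 + J h (-1))\<^sup>2"
    by (intro power_mono add_mono) (auto simp: m_def)
  finally show "integral\<^sup>N lborel f * integral\<^sup>N lborel g \<le> (integral\<^sup>N lborel h)\<^sup>2"
    by (simp add: J)
qed

section \<open>Unconditional log-concave densities\<close>

lemma borel_measurable_vec_lambda[measurable]:
  "(\<lambda>x. \<chi> i. x i) \<in> borel_measurable (Pi\<^sub>M UNIV (\<lambda>_::'n::finite. lborel :: real measure))"
proof (subst borel_measurable_euclidean_space, rule ballI)
  fix b :: "real^'n" assume "b \<in> Basis"
  then obtain j where b: "b = axis j 1" by (auto simp: Basis_vec_def)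
  show "(\<lambda>x. (\<chi> i. x i) \<bullet> b) \<in> borel_measurable (Pi\<^sub>M UNIV (\<lambda>_::'n. lborel :: real measure))"
    unfolding b by (simp add: inner_axis)
qed

text \<open>Lebesgue measure is determined by its values on boxes, and a box pulls back to a product
  of intervals. This transfers \<open>prekopa_leindler_PiM\<close> and Fubini to
  \<open>real^'n\<close>.\<close>

lemma lborel_vec_eq:
  "lborel = distr (Pi\<^sub>M UNIV (\<lambda>_::'n::finite. lborel :: real measure)) borel (\<lambda>x. \<chi> i. x i)"
proof (rule lborel_eqI)
  interpret product_sigma_finite "\<lambda>_::'n. lborel :: real measure" ..
  have Basis: "Basis = range (\<lambda>i::'n. axis i (1::real))" by (auto simp: Basis_vec_def)
  have inj: "inj (\<lambda>i::'n. axis i (1::real))" by (auto simp: inj_on_def axis_eq_axis)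
  fix l u :: "real^'n" assume lu: "\<And>b. b \<in> Basis \<Longrightarrow> l \<bullet> b \<le> u \<bullet> b"
  have le: "l $ i \<le> u $ i" for i
    using lu[of "axis i 1"] by (simp add: inner_axis)
  have "(\<lambda>x. \<chi> i. x i) -` box l u \<inter> space (Pi\<^sub>M UNIV (\<lambda>_::'n. lborel :: real measure))
      = Pi\<^sub>E UNIV (\<lambda>i. {l $ i <..< u $ i})"
    by (auto simp: space_PiM mem_box_cart PiE_def Pi_def)
  then have "emeasure (distr (Pi\<^sub>M UNIV (\<lambda>_::'n. lborel)) borel (\<lambda>x. \<chi> i. x i)) (box l u)
      = (\<Prod>i\<in>UNIV. emeasure lborel {l $ i <..< u $ i})"
    by (simp add: emeasure_distr emeasure_PiM)
  also have "\<dots> = (\<Prod>i\<in>UNIV. ennreal (u $ i - l $ i))" using le by simp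
  also have "\<dots> = ennreal (\<Prod>i\<in>UNIV. u $ i - l $ i)" using le by (simp add: prod_ennreal)
  also have "(\<Prod>i\<in>UNIV. u $ i - l $ i) = (\<Prod>b\<in>Basis. (u - l) \<bullet> b)"
    unfolding Basis by (subst prod.reindex[OF inj]) (simp add: inner_axis)
  finally show "emeasure (distr (Pi\<^sub>M UNIV (\<lambda>_::'n. lborel)) borel (\<lambda>x. \<chi> i. x i)) (box l u)
      = ennreal (\<Prod>b\<in>Basis. (u - l) \<bullet> b)" .
qed simp

lemma nn_integral_lborel_vec:
  fixes F :: "real^'n \<Rightarrow> ennreal"
  assumes [measurable]: "F \<in> borel_measurable borel"
  shows "integral\<^sup>N lborel F = (\<integral>\<^sup>+x. F (\<chi> i. x i) \<partial>Pi\<^sub>M UNIV (\<lambda>_. lborel))"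
  by (subst lborel_vec_eq) (simp add: nn_integral_distr)

text \<open>The first order integrates along lines parallel to the axis \<open>i\<close>, as needed
  for \<open>K\<close>; the second integrates over hyperplanes on which coordinate \<open>i\<close>
  is fixed, as needed for the polar.\<close>

lemma nn_integral_lborel_vec_split:
  fixes F :: "real^'n \<Rightarrow> ennreal" and i :: 'n
  assumes [measurable]: "F \<in> borel_measurable borel"
  shows "integral\<^sup>N lborel F
      = (\<integral>\<^sup>+x. (\<integral>\<^sup>+s. F (\<chi> j. (x(i := s)) j) \<partial>lborel) \<partial>Pi\<^sub>M (UNIV - {i}) (\<lambda>_. lborel))"
    and "integral\<^sup>N lborel F
      = (\<integral>\<^sup>+s. (\<integral>\<^sup>+x. F (\<chi> j. (x(i := s)) j) \<partial>Pi\<^sub>M (UNIV - {i}) (\<lambda>_. lborel)) \<partial>lborel)"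
proof -
  interpret product_sigma_finite "\<lambda>_::'n. lborel :: real measure" ..
  have U: "UNIV = insert i (UNIV - {i})" by auto
  have m: "(\<lambda>x. F (\<chi> j. x j)) \<in> borel_measurable (Pi\<^sub>M (insert i (UNIV - {i})) (\<lambda>_. lborel))"
    unfolding U[symmetric] by measurable
  show "integral\<^sup>N lborel F
      = (\<integral>\<^sup>+x. (\<integral>\<^sup>+s. F (\<chi> j. (x(i := s)) j) \<partial>lborel) \<partial>Pi\<^sub>M (UNIV - {i}) (\<lambda>_. lborel))"
    using product_nn_integral_insert[OF _ _ m] unfolding U[symmetric]
    by (simp add: nn_integral_lborel_vec)
  show "integral\<^sup>N lborel F
      = (\<integral>\<^sup>+s. (\<integral>\<^sup>+x. F (\<chi> j. (x(i := s)) j) \<partial>Pi\<^sub>M (UNIV - {i}) (\<lambda>_. lborel)) \<partial>lborel)"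
    using product_nn_integral_insert_rev[OF _ _ m] unfolding U[symmetric]
    by (simp add: nn_integral_lborel_vec)
qed

lemma borel_measurable_vec_lambda_update:
  fixes F :: "real^'n \<Rightarrow> ennreal"
  assumes [measurable]: "F \<in> borel_measurable borel"
  shows "x \<in> space (Pi\<^sub>M (UNIV - {i}) (\<lambda>_. lborel)) \<Longrightarrow> (\<lambda>s. F (\<chi> j. (x(i := s)) j)) \<in> borel_measurable lborel"
    and "(\<lambda>x. F (\<chi> j. (x(i := s)) j)) \<in> borel_measurable (Pi\<^sub>M (UNIV - {i}) (\<lambda>_. lborel))"
proof -
  have U: "UNIV = insert i (UNIV - {i})" by auto
  have m: "(\<lambda>x. F (\<chi> j. x j)) \<in> borel_measurable (Pi\<^sub>M (insert i (UNIV - {i})) (\<lambda>_. lborel))"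
    unfolding U[symmetric] by measurable
  note [measurable (raw)] = measurable_compose[OF _ m]
  show "x \<in> space (Pi\<^sub>M (UNIV - {i}) (\<lambda>_. lborel)) \<Longrightarrow> (\<lambda>s. F (\<chi> j. (x(i := s)) j)) \<in> borel_measurable lborel"
    by measurable
  show "(\<lambda>x. F (\<chi> j. (x(i := s)) j)) \<in> borel_measurable (Pi\<^sub>M (UNIV - {i}) (\<lambda>_. lborel))"
    by measurable
qed

section \<open>Consequences of log-concavity and unconditionality\<close>

lemma log_concave_densityD:
  assumes "log_concave_density f" "0 \<le> t" "t \<le> 1" "0 < f x" "0 < f y"
  defines "z \<equiv> (1 - t) *\<^sub>R x + t *\<^sub>R y"
  shows "0 < f z" and "(1 - t) * ln (f x) + t * ln (f y) \<le> ln (f z)"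
proof -
  have "ereal (1 - t) * elog (f x) + ereal t * elog (f y) \<le> elog (f z)"
    using assms unfolding log_concave_density_def by blast
  then have "ereal ((1 - t) * ln (f x) + t * ln (f y)) \<le> elog (f z)"
    using assms by (simp add: elog_def)
  then show "0 < f z" "(1 - t) * ln (f x) + t * ln (f y) \<le> ln (f z)"
    by (auto simp: elog_def split: if_splits)
qed

lemma log_concave_density_midpoint:
  assumes lc: "log_concave_density f"
  shows "f x * f y \<le> (f ((1/2) *\<^sub>R (x + y)))\<^sup>2"
proof (cases "0 < f x \<and> 0 < f y")
  case True
  have z: "(1 - 1/2) *\<^sub>R x + (1/2) *\<^sub>R y = (1/2) *\<^sub>R (x + y)"
    by (simp add: scaleR_add_right)
  have pos: "0 < f ((1/2) *\<^sub>R (x + y))"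
    and "(1 - 1/2) * ln (f x) + (1/2) * ln (f y) \<le> ln (f ((1/2) *\<^sub>R (x + y)))"
    using log_concave_densityD[OF lc, of "1/2" x y] True unfolding z by auto
  then have "ln (f x * f y) \<le> ln ((f ((1/2) *\<^sub>R (x + y)))\<^sup>2)"
    using True by (simp add: ln_mult ln_realpow)
  then show ?thesis using True pos by simp
next
  case False
  moreover have "0 \<le> f x" "0 \<le> f y" using lc by (auto simp: log_concave_density_def)
  ultimately show ?thesis by (auto simp: not_less)
qed

lemma log_concave_density_segment:
  assumes lc: "log_concave_density f" and eq: "f x = f y" and t: "0 \<le> t" "t \<le> 1"
  shows "f x \<le> f ((1 - t) *\<^sub>R x + t *\<^sub>R y)"
proof (cases "0 < f x")
  case True
  then have "0 < f ((1 - t) *\<^sub>R x + t *\<^sub>R y)" "ln (f x) \<le> ln (f ((1 - t) *\<^sub>R x + t *\<^sub>R y))"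
    using log_concave_densityD[OF lc t, of x y] eq by (auto simp: algebra_simps)
  then show ?thesis using True by simp
next
  case False
  then show ?thesis
    using lc unfolding log_concave_density_def by (meson order_trans not_less)
qed

text \<open>The coordinates of \<open>w\<close> are replaced by those of \<open>z\<close> one at a
  time. Each replacement moves the point along the segment to its mirror image in coordinate
  \<open>j\<close>; \<open>f\<close> agrees at both ends, so log-concavity keeps it from dropping in
  between.\<close>

lemma unconditional_log_concave_antimono:
  fixes f :: "real^'n \<Rightarrow> real"
  assumes lc: "log_concave_density f" and un: "unconditional f"
    and le: "\<And>i. \<bar>z $ i\<bar> \<le> \<bar>w $ i\<bar>"
  shows "f w \<le> f z"
proof -
  have "f w \<le> f (\<chi> i. if i \<in> J then z $ i else w $ i)" if "finite J" for J
    using that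
  proof (induction J)
    case empty
    then show ?case by simp
  next
    case (insert j J)
    define v where "v = (\<chi> i. if i \<in> J then z $ i else w $ i)"
    define \<epsilon> where "\<epsilon> i = (if i = j then -1 else 1 :: real)" for i
    \<comment> \<open>This solves \<open>(1 - 2 * t) * w $ j = z $ j\<close>. If
      \<open>w $ j = 0\<close>, then \<open>z $ j = 0\<close> too and the value 0 serves.\<close>
    define t where "t = (if w $ j = 0 then 0 else (1 - z $ j / w $ j) / 2)"
    have "\<bar>z $ j / w $ j\<bar> \<le> 1"
      using le[of j] by (cases "w $ j = 0") (simp_all add: abs_divide)
    then have "-1 \<le> z $ j / w $ j" "z $ j / w $ j \<le> 1"
      unfolding abs_le_iff by linarith+
    then have t: "0 \<le> t" "t \<le> 1"
      unfolding t_def by simp_all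
    have "f v = f (\<chi> i. \<epsilon> i * v $ i)"
      using un unfolding unconditional_def \<epsilon>_def by simp
    then have "f v \<le> f ((1 - t) *\<^sub>R v + t *\<^sub>R (\<chi> i. \<epsilon> i * v $ i))"
      by (rule log_concave_density_segment[OF lc _ t])
    also have "(1 - t) *\<^sub>R v + t *\<^sub>R (\<chi> i. \<epsilon> i * v $ i) = (\<chi> i. if i \<in> insert j J then z $ i else w $ i)"
      using insert.hyps le[of j] by (auto simp: vec_eq_iff v_def \<epsilon>_def t_def field_simps)
    finally show ?case using insert.IH unfolding v_def by simp
  qed
  from this[of UNIV] show ?thesis by simp
qed

text \<open>Sign changes leave \<open>f v\<close> unchanged, so the midpoint inequality applies to
  \<open>u\<close> and the flipped \<open>v\<close>. The choice of \<open>\<epsilon>\<close> allows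
  averages in some coordinates and half-differences in others.\<close>

lemma unconditional_log_concave_signed_midpoint:
  fixes f :: "real^'n \<Rightarrow> real"
  assumes lc: "log_concave_density f" and un: "unconditional f"
    and \<epsilon>: "\<And>i. \<epsilon> i = 1 \<or> \<epsilon> i = -1" and w: "\<And>i. w $ i = (u $ i + \<epsilon> i * v $ i) / 2"
  shows "f u * f v \<le> (f w)\<^sup>2"
proof -
  have "f u * f v = f u * f (\<chi> i. \<epsilon> i * v $ i)"
    using un \<epsilon> unfolding unconditional_def by metis
  also have "\<dots> \<le> (f ((1/2) *\<^sub>R (u + (\<chi> i. \<epsilon> i * v $ i))))\<^sup>2"
    by (rule log_concave_density_midpoint[OF lc])
  also have "(1/2) *\<^sub>R (u + (\<chi> i. \<epsilon> i * v $ i)) = w"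
    by (simp add: vec_eq_iff w)
  finally show ?thesis .
qed

text \<open>Splits the pointwise hypothesis of Prekopa-Leindler for a density restricted to sets
  into a membership claim and an inequality for the density.\<close>

lemma weighted_indicator_le:
  assumes nn: "\<And>x. 0 \<le> f x"
    and "u \<in> A \<Longrightarrow> v \<in> B \<Longrightarrow> w \<in> C" and "u \<in> A \<Longrightarrow> v \<in> B \<Longrightarrow> f u * f v \<le> (f w)\<^sup>2"
  shows "(ennreal (f u) * indicator A u) * (ennreal (f v) * indicator B v) \<le> (ennreal (f w) * indicator C w)\<^sup>2"
proof (cases "u \<in> A \<and> v \<in> B")
  case True
  then have "ennreal (f u * f v) \<le> ennreal ((f w)\<^sup>2)" using assms by (intro ennreal_leI) auto
  then show ?thesis using True assms by (simp add: ennreal_mult ennreal_power)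
qed auto

section \<open>Steiner symmetrization\<close>

text \<open>For convex \<open>K\<close> this is the usual symmetral: if the chord of \<open>K\<close> on a line parallel to \<open>e\<^sub>i\<close>
  is \<open>[b, a]\<close>, then \<open>(x\<^sub>i - y\<^sub>i)/2\<close> ranges over \<open>[-(a - b)/2, (a - b)/2]\<close>.\<close>
definition steiner :: "'n \<Rightarrow> (real^'n) set \<Rightarrow> (real^'n) set" where
  "steiner i K = {z. \<exists>x\<in>K. \<exists>y\<in>K. (\<forall>j. j \<noteq> i \<longrightarrow> x $ j = z $ j \<and> y $ j = z $ j) \<and> z $ i = (x $ i - y $ i) / 2}"

text \<open>The symmetral is a continuous image of the compact set of pairs in
  \<open>K \<times> K\<close> that agree outside coordinate \<open>i\<close>.\<close>

lemma compact_steiner: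
  fixes K :: "(real^'n) set"
  assumes "compact K"
  shows "compact (steiner i K)"
proof -
  let ?S = "{p :: (real^'n) \<times> (real^'n). \<forall>j. j \<noteq> i \<longrightarrow> fst p $ j = snd p $ j}"
  let ?g = "\<lambda>p :: (real^'n) \<times> (real^'n). \<chi> j. if j = i then (fst p $ i - snd p $ i) / 2 else fst p $ j"
  have "closed ?S"
    by (intro closed_Collect_all closed_Collect_imp closed_Collect_eq open_Collect_const continuous_intros)
  then have "compact ((K \<times> K) \<inter> ?S)"
    using assms by (intro compact_Int_closed compact_Times) auto
  moreover have "continuous_on ((K \<times> K) \<inter> ?S) ?g"
  proof (rule continuous_on_vec_lambda)
    fix j
    show "continuous_on ((K \<times> K) \<inter> ?S) (\<lambda>p. if j = i then (fst p $ i - snd p $ i) / 2 else fst p $ j)"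
      by (cases "j = i") (auto intro!: continuous_intros)
  qed
  moreover have "steiner i K = ?g ` ((K \<times> K) \<inter> ?S)"
  proof (intro equalityI subsetI)
    fix z assume "z \<in> steiner i K"
    then obtain x y where xy: "x \<in> K" "y \<in> K" "\<And>j. j \<noteq> i \<Longrightarrow> x $ j = z $ j \<and> y $ j = z $ j"
      "z $ i = (x $ i - y $ i) / 2" unfolding steiner_def by blast
    show "z \<in> ?g ` ((K \<times> K) \<inter> ?S)"
      using xy by (intro image_eqI[of _ _ "(x, y)"]) (auto simp: vec_eq_iff)
  next
    fix z assume "z \<in> ?g ` ((K \<times> K) \<inter> ?S)"
    then obtain p where "p \<in> (K \<times> K) \<inter> ?S" "z = ?g p" by blast
    then show "z \<in> steiner i K" unfolding steiner_def
      by (intro CollectI bexI[of _ "fst p"] bexI[of _ "snd p"]) auto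
  qed
  ultimately show ?thesis by (simp only: compact_continuous_image)
qed

lemma symmetric_set_iff: "symmetric_set K \<longleftrightarrow> (\<forall>x\<in>K. - x \<in> K)"
proof
  assume "\<forall>x\<in>K. - x \<in> K"
  moreover from this have "x \<in> uminus ` K" if "x \<in> K" for x
    using that by (intro image_eqI[of _ _ "- x"]) auto
  ultimately show "symmetric_set K" unfolding symmetric_set_def by blast
qed (auto simp: symmetric_set_def)

lemma symmetric_set_steiner:
  assumes "symmetric_set K"
  shows "symmetric_set (steiner i K)"
  unfolding symmetric_set_iff
proof
  fix z assume "z \<in> steiner i K"
  then obtain x y where "x \<in> K" "y \<in> K" "\<forall>j. j \<noteq> i \<longrightarrow> x $ j = z $ j \<and> y $ j = z $ j"
      "z $ i = (x $ i - y $ i) / 2" unfolding steiner_def by blast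
  then show "- z \<in> steiner i K"
    using assms unfolding steiner_def symmetric_set_iff
    by (intro CollectI bexI[of _ "- x"] bexI[of _ "- y"]) auto
qed

section \<open>Invariance under sign changes\<close>

text \<open>\<open>J\<close> records the coordinates already symmetrized; \<open>J = UNIV\<close>
  means that the set is unconditional.\<close>

definition sign_invariant :: "'n set \<Rightarrow> (real^'n) set \<Rightarrow> bool" where
  "sign_invariant J K \<longleftrightarrow> (\<forall>x\<in>K. \<forall>\<epsilon>. (\<forall>i. \<epsilon> i = 1 \<or> \<epsilon> i = -1) \<longrightarrow> (\<forall>i. i \<notin> J \<longrightarrow> \<epsilon> i = 1) \<longrightarrow>
     (\<chi> i. \<epsilon> i * x $ i) \<in> K)"

text \<open>Exchanging the two witnesses flips coordinate \<open>i\<close>. The signs from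
  \<open>J\<close> act on both witnesses at once, so invariances gained earlier persist.\<close>

lemma sign_invariant_steiner:
  assumes "sign_invariant J K"
  shows "sign_invariant (insert i J) (steiner i K)"
  unfolding sign_invariant_def
proof (intro ballI allI impI)
  fix z \<epsilon> assume z: "z \<in> steiner i K" and \<epsilon>: "\<forall>i. \<epsilon> i = 1 \<or> \<epsilon> i = (-1::real)" "\<forall>k. k \<notin> insert i J \<longrightarrow> \<epsilon> k = 1"
  obtain x y where xy: "x \<in> K" "y \<in> K" "\<forall>j. j \<noteq> i \<longrightarrow> x $ j = z $ j \<and> y $ j = z $ j"
      "z $ i = (x $ i - y $ i) / 2" using z unfolding steiner_def by blast
  \<comment> \<open>Without the sign at \<open>i\<close>, which the exchange of witnesses supplies,
    only coordinates in \<open>J\<close> are flipped.\<close>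
  define \<delta> where "\<delta> = \<epsilon>(i := 1)"
  have \<delta>: "\<forall>i. \<delta> i = 1 \<or> \<delta> i = -1" "\<forall>i. i \<notin> J \<longrightarrow> \<delta> i = 1"
    using \<epsilon> by (auto simp: \<delta>_def)
  have K: "(\<chi> i. \<delta> i * x $ i) \<in> K" "(\<chi> i. \<delta> i * y $ i) \<in> K"
    using assms \<delta> xy unfolding sign_invariant_def by blast+
  show "(\<chi> i. \<epsilon> i * z $ i) \<in> steiner i K"
  proof (cases "\<epsilon> i = 1")
    case True
    then show ?thesis unfolding steiner_def
      using K xy by (intro CollectI bexI[OF _ K(1)] bexI[OF _ K(2)]) (auto simp: \<delta>_def)
  next
    case False
    then have "\<epsilon> i = -1" using \<epsilon> by blast
    then show ?thesis unfolding steiner_def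
      using K xy by (intro CollectI bexI[OF _ K(2)] bexI[OF _ K(1)]) (auto simp: \<delta>_def)
  qed
qed

section \<open>The polar of the symmetral\<close>

text \<open>If \<open>x\<close>, \<open>y\<close> witness that \<open>z\<close> is in the symmetral,
  then \<open>z \<bullet> w\<close> is the mean of \<open>x \<bullet> u\<close> and
  \<open>(- y) \<bullet> v\<close>: coordinate \<open>i\<close> uses the common height
  \<open>s\<close>, the others use \<open>x $ j = y $ j = z $ j\<close>. Symmetry of
  \<open>K\<close> gives \<open>- y \<in> K\<close>.\<close>

lemma steiner_polar_mem:
  assumes sym: "symmetric_set K" and uv: "u \<in> polar K" "v \<in> polar K"
    and i: "u $ i = s" "v $ i = s" "w $ i = s" and w: "\<And>j. j \<noteq> i \<Longrightarrow> w $ j = (u $ j - v $ j) / 2"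
  shows "w \<in> polar (steiner i K)"
  unfolding polar_def
proof (intro CollectI ballI)
  fix z assume "z \<in> steiner i K"
  then obtain x y where xy: "x \<in> K" "y \<in> K" "\<forall>j. j \<noteq> i \<longrightarrow> x $ j = z $ j \<and> y $ j = z $ j"
      "z $ i = (x $ i - y $ i) / 2" unfolding steiner_def by blast
  have "z $ j * w $ j = (x $ j * u $ j + (- y) $ j * v $ j) / 2" for j
  proof (cases "j = i")
    case True
    then have "z $ j * w $ j = (x $ i - y $ i) / 2 * s" using xy i by simp
    then show ?thesis using True i by (simp add: field_simps)
  next
    case False
    then have "z $ j * w $ j = z $ j * ((u $ j - v $ j) / 2)" using w by simp
    then show ?thesis using False xy(3) by (simp add: field_simps)
  qed
  then have "z \<bullet> w = (x \<bullet> u + (- y) \<bullet> v) / 2"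
    by (simp add: inner_vec_def sum_divide_distrib[symmetric] sum.distrib del: vector_uminus_component eq_divide_eq_numeral1)
  moreover have "x \<bullet> u \<le> 1" "(- y) \<bullet> v \<le> 1"
    using xy uv sym unfolding polar_def symmetric_set_iff by blast+
  ultimately show "z \<bullet> w \<le> 1" by simp
qed

lemma closed_polar: "closed (polar K)"
proof -
  have "polar K = (\<Inter>x\<in>K. {y. x \<bullet> y \<le> 1})" unfolding polar_def by auto
  then show ?thesis by (simp add: closed_INT closed_halfspace_le)
qed

section \<open>Monotonicity of the measures under symmetrization\<close>

abbreviation weighted :: "(real^'n \<Rightarrow> real) \<Rightarrow> (real^'n) measure" where
  "weighted f \<equiv> density lborel (\<lambda>x. ennreal (f x))"

lemma emeasure_weighted:
  assumes [measurable]: "f \<in> borel_measurable borel" "A \<in> sets borel"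
  shows "emeasure (weighted f) A = (\<integral>\<^sup>+x. ennreal (f x) * indicator A x \<partial>lborel)"
  by (rule emeasure_density) auto

lemma emeasure_le_steiner:
  fixes f :: "real^'n \<Rightarrow> real"
  assumes lc: "log_concave_density f" and un: "unconditional f" and K: "compact K"
  shows "emeasure (weighted f) K \<le> emeasure (weighted f) (steiner i K)"
proof -
  have [measurable]: "f \<in> borel_measurable borel" and nn: "\<And>x. 0 \<le> f x"
    using lc by (auto simp: log_concave_density_def)
  have [measurable]: "K \<in> sets borel" "steiner i K \<in> sets borel"
    using K compact_steiner[OF K] by (auto intro: borel_compact)
  define F where "F A x = ennreal (f x) * indicator A x" for A and x :: "real^'n"
  have [measurable]: "F K \<in> borel_measurable borel" "F (steiner i K) \<in> borel_measurable borel"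
    unfolding F_def by measurable
  have "(\<integral>\<^sup>+s. F K (\<chi> j. (x(i := s)) j) \<partial>lborel) \<le> (\<integral>\<^sup>+s. F (steiner i K) (\<chi> j. (x(i := s)) j) \<partial>lborel)"
    if x: "x \<in> space (Pi\<^sub>M (UNIV - {i}) (\<lambda>_. lborel))" for x
  proof -
    \<comment> \<open>Prekopa-Leindler with equal first and second functions compares two squares,
      so the bases can be compared.\<close>
    have "(\<integral>\<^sup>+s. F K (\<chi> j. (x(i := s)) j) \<partial>lborel) * (\<integral>\<^sup>+s. F K (\<chi> j. (x(i := s)) j) \<partial>lborel)
        \<le> (\<integral>\<^sup>+s. F (steiner i K) (\<chi> j. (x(i := s)) j) \<partial>lborel)\<^sup>2"
    proof (rule prekopa_leindlerD[OF prekopa_leindler_lborel_diff])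
      fix s t r :: real assume r: "r = (s - t) / 2"
      show "F K (\<chi> j. (x(i := s)) j) * F K (\<chi> j. (x(i := t)) j) \<le> (F (steiner i K) (\<chi> j. (x(i := r)) j))\<^sup>2"
        unfolding F_def
      proof (rule weighted_indicator_le[OF nn])
        assume "(\<chi> j. (x(i := s)) j) \<in> K" "(\<chi> j. (x(i := t)) j) \<in> K"
        then show "(\<chi> j. (x(i := r)) j) \<in> steiner i K"
          unfolding steiner_def r
            by (intro CollectI bexI[of _ "\<chi> j. (x(i := s)) j"] bexI[of _ "\<chi> j. (x(i := t)) j"]) auto
        show "f (\<chi> j. (x(i := s)) j) * f (\<chi> j. (x(i := t)) j) \<le> (f (\<chi> j. (x(i := r)) j))\<^sup>2"
          \<comment> \<open>Only coordinate \<open>i\<close> is flipped; the two points share all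
            others, so averaging preserves them.\<close>
          by (rule unconditional_log_concave_signed_midpoint[OF lc un, where \<epsilon>="\<lambda>j. if j = i then -1 else 1"])
            (auto simp: r)
      qed
    qed (intro borel_measurable_vec_lambda_update x; measurable)+
    then show ?thesis by (simp add: power2_eq_square[symmetric] ennreal_power2_le_iff)
  qed
  then have "integral\<^sup>N lborel (F K) \<le> integral\<^sup>N lborel (F (steiner i K))"
    by (simp add: nn_integral_lborel_vec_split(1)[of _ i] nn_integral_mono del: fun_upd_apply)
  then show ?thesis unfolding F_def by (simp add: emeasure_weighted)
qed

text \<open>On the hyperplane at height \<open>s\<close>, the tensorized difference inequality is
  applied to the slice of \<open>polar K\<close> paired with itself;
  \<open>steiner_polar_mem\<close> places the half-differences in the polar of the
  symmetral.\<close>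

lemma emeasure_polar_le_steiner:
  fixes f :: "real^'n \<Rightarrow> real"
  assumes lc: "log_concave_density f" and un: "unconditional f" and K: "symmetric_set K"
  shows "emeasure (weighted f) (polar K) \<le> emeasure (weighted f) (polar (steiner i K))"
proof -
  have [measurable]: "f \<in> borel_measurable borel" and nn: "\<And>x. 0 \<le> f x"
    using lc by (auto simp: log_concave_density_def)
  have [measurable]: "polar K \<in> sets borel" "polar (steiner i K) \<in> sets borel"
    by (intro borel_closed closed_polar)+
  define F where "F A x = ennreal (f x) * indicator A x" for A and x :: "real^'n"
  have [measurable]: "F (polar K) \<in> borel_measurable borel" "F (polar (steiner i K)) \<in> borel_measurable borel"
    unfolding F_def by measurable
  let ?N = "Pi\<^sub>M (UNIV - {i}) (\<lambda>_. lborel) :: ('n \<Rightarrow> real) measure"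
  have pl: "prekopa_leindler ?N (\<lambda>x y z. \<forall>j\<in>UNIV - {i}. z j = (x j - y j) / 2)"
    by (rule prekopa_leindler_PiM) (simp, rule sigma_finite_lborel, rule prekopa_leindler_lborel_diff)
  have "(\<integral>\<^sup>+x. F (polar K) (\<chi> j. (x(i := s)) j) \<partial>?N) \<le> (\<integral>\<^sup>+x. F (polar (steiner i K)) (\<chi> j. (x(i := s)) j) \<partial>?N)" for s
  proof -
    have "(\<integral>\<^sup>+x. F (polar K) (\<chi> j. (x(i := s)) j) \<partial>?N) * (\<integral>\<^sup>+x. F (polar K) (\<chi> j. (x(i := s)) j) \<partial>?N)
        \<le> (\<integral>\<^sup>+x. F (polar (steiner i K)) (\<chi> j. (x(i := s)) j) \<partial>?N)\<^sup>2"
    proof (rule prekopa_leindlerD[OF pl])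
      fix x y z :: "'n \<Rightarrow> real" assume z: "\<forall>j\<in>UNIV - {i}. z j = (x j - y j) / 2"
      show "F (polar K) (\<chi> j. (x(i := s)) j) * F (polar K) (\<chi> j. (y(i := s)) j)
          \<le> (F (polar (steiner i K)) (\<chi> j. (z(i := s)) j))\<^sup>2"
        unfolding F_def
      proof (rule weighted_indicator_le[OF nn])
        assume "(\<chi> j. (x(i := s)) j) \<in> polar K" "(\<chi> j. (y(i := s)) j) \<in> polar K"
        then show "(\<chi> j. (z(i := s)) j) \<in> polar (steiner i K)"
          by (rule steiner_polar_mem[OF K]) (use z in auto)
        show "f (\<chi> j. (x(i := s)) j) * f (\<chi> j. (y(i := s)) j) \<le> (f (\<chi> j. (z(i := s)) j))\<^sup>2"
          \<comment> \<open>The signs are opposite to those used for \<open>K\<close>: the shared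
            height in coordinate \<open>i\<close> is averaged, all other coordinates are
            subtracted.\<close>
          using z by (intro unconditional_log_concave_signed_midpoint[OF lc un, where \<epsilon>="\<lambda>j. if j = i then 1 else -1"])
            auto
      qed
    qed (intro borel_measurable_vec_lambda_update; measurable)+
    then show ?thesis by (simp add: power2_eq_square[symmetric] ennreal_power2_le_iff)
  qed
  then have "integral\<^sup>N lborel (F (polar K)) \<le> integral\<^sup>N lborel (F (polar (steiner i K)))"
    by (simp add: nn_integral_lborel_vec_split(2)[of _ i] nn_integral_mono del: fun_upd_apply)
  then show ?thesis unfolding F_def by (simp add: emeasure_weighted)
qed

text \<open>Symmetrization in the coordinates of \<open>J\<close>, one after the other. Compactness
  and symmetry are carried along so that both monotonicity results apply at each step.\<close>

lemma exists_sign_invariant_majorant: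
  fixes f :: "real^'n \<Rightarrow> real"
  assumes lc: "log_concave_density f" and un: "unconditional f" and K: "compact K" "symmetric_set K"
    and "finite J"
  shows "\<exists>L. compact L \<and> symmetric_set L \<and> sign_invariant J L \<and>
    emeasure (weighted f) K \<le> emeasure (weighted f) L \<and>
    emeasure (weighted f) (polar K) \<le> emeasure (weighted f) (polar L)"
  using \<open>finite J\<close>
proof (induction J)
  case empty
  have "sign_invariant {} K" unfolding sign_invariant_def by simp
  then show ?case using K by blast
next
  case (insert i J)
  then obtain L where L: "compact L" "symmetric_set L" "sign_invariant J L"
    "emeasure (weighted f) K \<le> emeasure (weighted f) L"
    "emeasure (weighted f) (polar K) \<le> emeasure (weighted f) (polar L)" by blast
  then show ?case
    using compact_steiner[OF L(1)] symmetric_set_steiner[OF L(2)] sign_invariant_steiner[OF L(3)]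
      order_trans[OF L(4) emeasure_le_steiner[OF lc un L(1)]]
      order_trans[OF L(5) emeasure_polar_le_steiner[OF lc un L(2)]]
    by (intro exI[of _ "steiner i L"] conjI)
qed

section \<open>The inequality for sign-invariant sets\<close>

text \<open>Flipping the coordinates of \<open>x\<close> so that every product with \<open>y\<close>
  becomes nonnegative stays inside \<open>L\<close>. With
  \<open>(z $ i)\<^sup>2 = \<bar>x $ i * y $ i\<bar>\<close> this is the bound that puts
  \<open>z\<close> in the unit ball.\<close>

lemma sign_invariant_polar_sum_le:
  assumes L: "sign_invariant UNIV L" and x: "x \<in> L" and y: "y \<in> polar L"
  shows "(\<Sum>i\<in>UNIV. \<bar>x $ i * y $ i\<bar>) \<le> 1"
proof -
  define \<epsilon> where "\<epsilon> i = (if 0 \<le> x $ i * y $ i then 1 else -1 :: real)" for i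
  have "(\<chi> i. \<epsilon> i * x $ i) \<in> L"
    using L x unfolding sign_invariant_def by (simp add: \<epsilon>_def)
  then have "(\<chi> i. \<epsilon> i * x $ i) \<bullet> y \<le> 1" using y unfolding polar_def by blast
  moreover have "(\<chi> i. \<epsilon> i * x $ i) \<bullet> y = (\<Sum>i\<in>UNIV. \<bar>x $ i * y $ i\<bar>)"
    unfolding inner_vec_def by (intro sum.cong) (auto simp: \<epsilon>_def)
  ultimately show ?thesis by simp
qed

lemma santalo_sign_invariant:
  fixes f :: "real^'n \<Rightarrow> real"
  assumes lc: "log_concave_density f" and un: "unconditional f"
    and L: "compact L" "sign_invariant UNIV L"
  shows "emeasure (weighted f) L * emeasure (weighted f) (polar L) \<le> (emeasure (weighted f) (cball 0 1))\<^sup>2"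
proof -
  have [measurable]: "f \<in> borel_measurable borel" and nn: "\<And>x. 0 \<le> f x"
    using lc by (auto simp: log_concave_density_def)
  have [measurable]: "L \<in> sets borel" "polar L \<in> sets borel" "cball (0::real^'n) 1 \<in> sets borel"
    using L by (auto intro: borel_compact borel_closed closed_polar)
  define F where "F A x = ennreal (f x) * indicator A x" for A and x :: "real^'n"
  have [measurable]: "F L \<in> borel_measurable borel" "F (polar L) \<in> borel_measurable borel"
    "F (cball 0 1) \<in> borel_measurable borel"
    unfolding F_def by measurable
  let ?N = "Pi\<^sub>M UNIV (\<lambda>_. lborel) :: ('n \<Rightarrow> real) measure"
  have pl: "prekopa_leindler ?N (\<lambda>x y z. \<forall>j\<in>UNIV. (z j)\<^sup>2 = \<bar>x j * y j\<bar>)"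
    by (rule prekopa_leindler_PiM) (simp, rule sigma_finite_lborel, rule prekopa_leindler_lborel_mult)
  have "(\<integral>\<^sup>+x. F L (\<chi> j. x j) \<partial>?N) * (\<integral>\<^sup>+x. F (polar L) (\<chi> j. x j) \<partial>?N)
      \<le> (\<integral>\<^sup>+x. F (cball 0 1) (\<chi> j. x j) \<partial>?N)\<^sup>2"
  proof (rule prekopa_leindlerD[OF pl])
    fix x y z :: "'n \<Rightarrow> real" assume z: "\<forall>j\<in>UNIV. (z j)\<^sup>2 = \<bar>x j * y j\<bar>"
    show "F L (\<chi> j. x j) * F (polar L) (\<chi> j. y j) \<le> (F (cball 0 1) (\<chi> j. z j))\<^sup>2"
      unfolding F_def
    proof (rule weighted_indicator_le[OF nn])
      assume xy: "(\<chi> j. x j) \<in> L" "(\<chi> j. y j) \<in> polar L"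
      have "(norm (\<chi> j. z j))\<^sup>2 = (\<Sum>j\<in>UNIV. \<bar>x j * y j\<bar>)"
        using z unfolding power2_norm_eq_inner inner_vec_def by (simp flip: power2_eq_square)
      also have "\<dots> \<le> 1" using sign_invariant_polar_sum_le[OF L(2) xy] by simp
      finally show "(\<chi> j. z j) \<in> cball 0 1" by (simp add: abs_square_le_1)
      \<comment> \<open>These signs give \<open>x j * (\<epsilon> j * y j) = (z j)\<^sup>2\<close>,
        so \<open>z\<close> is dominated in absolute value by the signed midpoint, by the
        arithmetic-geometric mean inequality. Monotonicity of \<open>f\<close> then passes from the
        midpoint to \<open>z\<close>.\<close>
      define \<epsilon> where "\<epsilon> j = (if 0 \<le> x j * y j then 1 else -1 :: real)" for j
      have "f (\<chi> j. x j) * f (\<chi> j. y j) \<le> (f (\<chi> j. (x j + \<epsilon> j * y j) / 2))\<^sup>2"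
        by (rule unconditional_log_concave_signed_midpoint[OF lc un, where \<epsilon>=\<epsilon>]) (auto simp: \<epsilon>_def)
      also have "\<dots> \<le> (f (\<chi> j. z j))\<^sup>2"
      proof (intro power_mono nn unconditional_log_concave_antimono[OF lc un])
        fix j
        have "(z j)\<^sup>2 = x j * (\<epsilon> j * y j)" using z by (auto simp: \<epsilon>_def)
        also have "\<dots> \<le> ((x j + \<epsilon> j * y j) / 2)\<^sup>2"
          using zero_le_power2[of "x j - \<epsilon> j * y j"] by (simp add: power2_eq_square field_simps)
        finally show "\<bar>(\<chi> j. z j) $ j\<bar> \<le> \<bar>(\<chi> j. (x j + \<epsilon> j * y j) / 2) $ j\<bar>"
          by (simp only: abs_le_square_iff vec_lambda_beta)
      qed
      finally show "f (\<chi> j. x j) * f (\<chi> j. y j) \<le> (f (\<chi> j. z j))\<^sup>2" .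
    qed
  qed measurable
  then have "integral\<^sup>N lborel (F L) * integral\<^sup>N lborel (F (polar L)) \<le> (integral\<^sup>N lborel (F (cball 0 1)))\<^sup>2"
    by (simp add: nn_integral_lborel_vec)
  then show ?thesis unfolding F_def by (simp add: emeasure_weighted)
qed

theorem theorem1:
  fixes f :: "real^'n \<Rightarrow> real" and K :: "(real^'n) set"
  assumes "log_concave_density f"
    and "unconditional f"
    and "convex_body K"
    and "symmetric_set K"
  shows "emeasure (density lborel (\<lambda>x. ennreal (f x))) K
           * emeasure (density lborel (\<lambda>x. ennreal (f x))) (polar K)
         \<le> (emeasure (density lborel (\<lambda>x. ennreal (f x))) (cball 0 1))\<^sup>2"
proof -
  have "compact K" using assms(3) by (simp add: convex_body_def)
  then obtain L where L: "compact L" "sign_invariant UNIV L"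
    "emeasure (weighted f) K \<le> emeasure (weighted f) L"
    "emeasure (weighted f) (polar K) \<le> emeasure (weighted f) (polar L)"
    using exists_sign_invariant_majorant[OF assms(1,2) _ assms(4), of UNIV] by auto
  have "emeasure (weighted f) K * emeasure (weighted f) (polar K)
      \<le> emeasure (weighted f) L * emeasure (weighted f) (polar L)"
    by (intro mult_mono L) auto
  also have "\<dots> \<le> (emeasure (weighted f) (cball 0 1))\<^sup>2"
    by (rule santalo_sign_invariant[OF assms(1,2) L(1,2)])
  finally show ?thesis .
qed

end
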